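(* Let $K$ be an arbitrary field, let $G$ be an arbitrary finite group and $S$ a generating set of $G$, and let $E_{G,S}$ be the Cayley graph of $G$ with respect to $S$. The following conditions are equivalent: (1) $L_K(E_{G,S})$ has IBN; (2) $L_K(E_{G,S})$ has gr-IBN; (3) $S$ contains only one element; (4) $E_{G,S}$ is a graph consisting of a single cycle with $|G|$ vertices.
   Context: A directed graph $E=(E^0,E^1,s,r)$ consists of disjoint sets $E^0$ (vertices) and $E^1$ (edges) with maps $s,r:E^1\to E^0$ (source, range). A vertex $v$ is regular if $0<|s^{-1}(v)|<\infty$. A graph consisting of a single cycle with $n$ vertices has $n$ vertices $u_1,\dots,u_n$ and $n$ edges $e_1,\dots,e_n$ with $s(e_i)=u_i$, $r(e_i)=u_{i+1}$ (indices mod $n$); for $n=1$ it is a single loop. For any finite group $G$ and any set of generators $S$ of $G$, the Cayley graph $E_{G,S}$ of $G$ with respect to $S$ is the directed graph with vertex set $\{v_g\mid g\in G\}$ in which there is an edge from $v_g$ to $v_h$ in case there exists $s\in S$ with $h=gs$ in $G$ (so there is one edge $v_g\to v_{gs}$ for each $g\in G$ and $s\in S$). The Leavitt path algebra $L_K(E)$ is the $K$-algebra generated by $E^0\cup E^1\cup\{e^*\mid e\in E^1\}$ subject to, for all $v,w\in E^0$ and $e,f\in E^1$: (i) $vw=\delta_{v,w}w$; (ii) $s(e)e=e=er(e)$ and $r(e)e^*=e^*=e^*s(e)$; (iii) $e^*f=\delta_{e,f}r(e)$; (iv) $v=\sum_{e\in s^{-1}(v)}ee^*$ for every regular vertex $v$.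 It is $\mathbb{Z}$-graded with $\deg v=0$, $\deg e=1$, $\deg e^*=-1$. A ring $R$ has IBN (Invariant Basis Number) if for all positive integers $m,n$, $R^m\cong R^n$ as right $R$-modules implies $m=n$. For an abelian group $\Gamma$, a $\Gamma$-graded ring $R$ and $\delta\in\Gamma$, the shifted graded right module $R(\delta)$ has components $R(\delta)_\gamma=R_{\delta+\gamma}$; $\cong_{gr}$ denotes isomorphism of right modules preserving degrees. $R$ has gr-IBN (Graded Invariant Basis Number) if for all positive integers $m,n$ and all $\alpha_1,\dots,\alpha_m,\beta_1,\dots,\beta_n\in\Gamma$, $R(\alpha_1)\oplus\cdots\oplus R(\alpha_m)\cong_{gr}R(\beta_1)\oplus\cdots\oplus R(\beta_n)$ as graded right $R$-modules implies $m=n$. Here gr-IBN for $L_K(E_{G,S})$ refers to the $\mathbb{Z}$-grading above.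
   Formalization: The generating set S is assumed nonempty: for the trivial group G with S empty, the graph is one vertex without edges, L_K(E) = K has IBN and gr-IBN, but (3) and (4) fail. *)

theory Defs
  imports
    "HOL-Algebra.QuotRing"
    "HOL-Algebra.Generated_Groups"
    "HOL-Library.Poly_Mapping"
    "HOL-Library.FuncSet"
    "Graph_Theory.Digraph"
begin

section \<open>Invariant basis number\<close>

text \<open>
  The library's modules are over commutative rings only, so right modules over an arbitrary ring
  are set up here, with \<open>ract M x r\<close> for the right action \<open>x \<cdot> r\<close>.
\<close>

record ('r, 'm) right_module = "'m partial_object" +
  radd :: "'m \<Rightarrow> 'm \<Rightarrow> 'm"
  ract :: "'m \<Rightarrow> 'r \<Rightarrow> 'm"

definition free_rmod :: "('a, 'b) ring_scheme \<Rightarrow> nat \<Rightarrow> ('a, nat \<Rightarrow> 'a) right_module" where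
  "free_rmod R n =
    \<lparr>carrier = {..<n} \<rightarrow>\<^sub>E carrier R,
     radd = (\<lambda>x y. \<lambda>i\<in>{..<n}. x i \<oplus>\<^bsub>R\<^esub> y i),
     ract = (\<lambda>x r. \<lambda>i\<in>{..<n}. x i \<otimes>\<^bsub>R\<^esub> r)\<rparr>"

definition rmod_iso ::
  "('a, 'b) ring_scheme \<Rightarrow> ('a, 'm) right_module \<Rightarrow> ('a, 'n) right_module \<Rightarrow> ('m \<Rightarrow> 'n) set" where
  "rmod_iso R M N =
    {\<phi>. bij_betw \<phi> (carrier M) (carrier N) \<and>
        (\<forall>x\<in>carrier M. \<forall>y\<in>carrier M. \<phi> (radd M x y) = radd N (\<phi> x) (\<phi> y)) \<and>
        (\<forall>x\<in>carrier M. \<forall>r\<in>carrier R. \<phi> (ract M x r) = ract N (\<phi> x) r)}"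

definition has_IBN :: "('a, 'b) ring_scheme \<Rightarrow> bool" where
  "has_IBN R \<longleftrightarrow>
    (\<forall>m>0. \<forall>n>0. rmod_iso R (free_rmod R m) (free_rmod R n) \<noteq> {} \<longrightarrow> m = n)"

text \<open>
  A grading of \<open>R\<close> is given by its family \<open>A\<close> of homogeneous components. The module
  \<open>R(\<alpha>\<^sub>0) \<oplus> \<dots> \<oplus> R(\<alpha>\<^bsub>n-1\<^esub>)\<close> is \<open>R\<^sup>n\<close> as an ungraded module; its component of degree
  \<open>\<gamma>\<close> is the following set, since \<open>R(\<delta>)\<^sub>\<gamma> = R\<^bsub>\<delta>+\<gamma>\<^esub>\<close>.
\<close>

definition shift_component ::
  "('d::ab_group_add \<Rightarrow> 'a set) \<Rightarrow> nat \<Rightarrow> (nat \<Rightarrow> 'd) \<Rightarrow> 'd \<Rightarrow> (nat \<Rightarrow> 'a) set" where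
  "shift_component A n \<alpha> \<gamma> = (\<Pi>\<^sub>E i\<in>{..<n}. A (\<alpha> i + \<gamma>))"

definition has_gr_IBN :: "('a, 'b) ring_scheme \<Rightarrow> ('d::ab_group_add \<Rightarrow> 'a set) \<Rightarrow> bool" where
  "has_gr_IBN R A \<longleftrightarrow>
    (\<forall>m>0. \<forall>n>0. \<forall>\<alpha> \<beta>.
      (\<exists>\<phi>\<in>rmod_iso R (free_rmod R m) (free_rmod R n).
         \<forall>\<gamma>. \<phi> ` shift_component A m \<alpha> \<gamma> \<subseteq> shift_component A n \<beta> \<gamma>)
      \<longrightarrow> m = n)"


section \<open>Free algebras\<close>

text \<open>
  Words are wrapped lists, so that concatenation can be the monoid operation on them and the
  convolution product on finitely supported functions becomes the product of the free algebra.
\<close>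

datatype 'x word = Word (letters: "'x list")

instantiation word :: (type) monoid_add
begin

definition zero_word :: "'a word" where
  "0 = Word []"

definition plus_word :: "'a word \<Rightarrow> 'a word \<Rightarrow> 'a word" where
  "v + w = Word (letters v @ letters w)"

instance
  by standard (simp_all add: zero_word_def plus_word_def)

end

text \<open>
  The unital free algebra on \<open>X\<close>; a letter \<open>x\<close> is the element \<open>gen x\<close>. The argument \<open>K\<close> only
  fixes the coefficient field.
\<close>

definition gen :: "'x \<Rightarrow> 'x word \<Rightarrow>\<^sub>0 'k::field" where
  "gen x = Poly_Mapping.single (Word [x]) 1"

definition free_algebra :: "'k::field itself \<Rightarrow> 'x set \<Rightarrow> ('x word \<Rightarrow>\<^sub>0 'k) ring" where
  "free_algebra K X =
    \<lparr>carrier = {p. \<forall>w\<in>Poly_Mapping.keys p. set (letters w) \<subseteq> X},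
     mult = (*), one = 1, zero = 0, add = (+)\<rparr>"


section \<open>Leavitt path algebras\<close>

datatype ('v, 'e) lpa_gen = Vertex 'v | Edge 'e | Ghost 'e

definition lpa_gens :: "('v, 'e) pre_digraph \<Rightarrow> ('v, 'e) lpa_gen set" where
  "lpa_gens E = Vertex ` verts E \<union> Edge ` arcs E \<union> Ghost ` arcs E"

definition regular_vertex :: "('v, 'e) pre_digraph \<Rightarrow> 'v \<Rightarrow> bool" where
  "regular_vertex E v \<longleftrightarrow> v \<in> verts E \<and> out_arcs E v \<noteq> {} \<and> finite (out_arcs E v)"

definition lpa_relators ::
  "'k::field itself \<Rightarrow> ('v, 'e) pre_digraph \<Rightarrow> (('v, 'e) lpa_gen word \<Rightarrow>\<^sub>0 'k) set" where
  "lpa_relators K E =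
     {gen (Vertex v) * gen (Vertex w) - (if v = w then gen (Vertex w) else 0) | v w.
        v \<in> verts E \<and> w \<in> verts E}
   \<union> {gen (Vertex (tail E e)) * gen (Edge e) - gen (Edge e) | e. e \<in> arcs E}
   \<union> {gen (Edge e) * gen (Vertex (head E e)) - gen (Edge e) | e. e \<in> arcs E}
   \<union> {gen (Vertex (head E e)) * gen (Ghost e) - gen (Ghost e) | e. e \<in> arcs E}
   \<union> {gen (Ghost e) * gen (Vertex (tail E e)) - gen (Ghost e) | e. e \<in> arcs E}
   \<union> {gen (Ghost e) * gen (Edge f) - (if e = f then gen (Vertex (head E e)) else 0) | e f.
        e \<in> arcs E \<and> f \<in> arcs E}
   \<union> {gen (Vertex v) - (\<Sum>e\<in>out_arcs E v. gen (Edge e) * gen (Ghost e)) | v.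
        regular_vertex E v}"

definition lpa_ideal ::
  "'k::field itself \<Rightarrow> ('v, 'e) pre_digraph \<Rightarrow> (('v, 'e) lpa_gen word \<Rightarrow>\<^sub>0 'k) set" where
  "lpa_ideal K E = Idl\<^bsub>free_algebra K (lpa_gens E)\<^esub> (lpa_relators K E)"

definition lpa_class ::
  "'k::field itself \<Rightarrow> ('v, 'e) pre_digraph \<Rightarrow> (('v, 'e) lpa_gen word \<Rightarrow>\<^sub>0 'k)
    \<Rightarrow> (('v, 'e) lpa_gen word \<Rightarrow>\<^sub>0 'k) set" where
  "lpa_class K E p = lpa_ideal K E +>\<^bsub>free_algebra K (lpa_gens E)\<^esub> p"

text \<open>
  The defining presentation is one of not necessarily unital algebras: the empty word of the
  unital free algebra is not an element of \<open>L\<^sub>K(E)\<close>. The elements without constant term form the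
  non-unital free algebra; the ideal the relators generate in it is the same set \<open>lpa_ideal\<close>.
  So \<open>L\<^sub>K(E)\<close> is the subring of the quotient represented by these elements. If \<open>E\<close> has finitely
  many vertices, their sum is its identity (and the field \<open>one\<close> is meaningful only then).
\<close>

definition leavitt ::
  "'k::field itself \<Rightarrow> ('v, 'e) pre_digraph \<Rightarrow> (('v, 'e) lpa_gen word \<Rightarrow>\<^sub>0 'k) set ring" where
  "leavitt K E =
    (free_algebra K (lpa_gens E) Quot lpa_ideal K E)
      \<lparr>carrier := lpa_class K E `
         {p \<in> carrier (free_algebra K (lpa_gens E)). Poly_Mapping.lookup p 0 = 0},
       one := lpa_class K E (\<Sum>v\<in>verts E. gen (Vertex v))\<rparr>"

fun gen_degree :: "('v, 'e) lpa_gen \<Rightarrow> int" where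
  "gen_degree (Vertex v) = 0"
| "gen_degree (Edge e) = 1"
| "gen_degree (Ghost e) = -1"

definition word_degree :: "('v, 'e) lpa_gen word \<Rightarrow> int" where
  "word_degree w = sum_list (map gen_degree (letters w))"

definition leavitt_component ::
  "'k::field itself \<Rightarrow> ('v, 'e) pre_digraph \<Rightarrow> int \<Rightarrow> (('v, 'e) lpa_gen word \<Rightarrow>\<^sub>0 'k) set set" where
  "leavitt_component K E d = lpa_class K E `
     {p \<in> carrier (free_algebra K (lpa_gens E)).
        Poly_Mapping.lookup p 0 = 0 \<and> (\<forall>w\<in>Poly_Mapping.keys p. word_degree w = d)}"


section \<open>Graphs\<close>

definition cayley_graph :: "('g, 'b) monoid_scheme \<Rightarrow> 'g set \<Rightarrow> ('g, 'g \<times> 'g) pre_digraph" where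
  "cayley_graph G S =
    \<lparr>verts = carrier G, arcs = carrier G \<times> S, tail = fst, head = (\<lambda>(g, s). g \<otimes>\<^bsub>G\<^esub> s)\<rparr>"

definition is_single_cycle :: "('v, 'e) pre_digraph \<Rightarrow> nat \<Rightarrow> bool" where
  "is_single_cycle E n \<longleftrightarrow> n > 0 \<and>
    (\<exists>u e. bij_betw u {..<n} (verts E) \<and> bij_betw e {..<n} (arcs E) \<and>
       (\<forall>i<n. tail E (e i) = u i \<and> head E (e i) = u (Suc i mod n)))"

end

theory Submission
  imports Defs "HOL-Library.Function_Algebras" "HOL-Algebra.Multiplicative_Group"
begin

text \<open>
  IBN implies gr-IBN because a graded isomorphism is in particular an isomorphism. Everything else
  hinges on how the \<open>|S|\<close> generators act on the vertices: \<open>g \<mapsto> g s\<close> is a permutation of \<open>G\<close> for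
  every \<open>s \<in> S\<close>, so the arcs of the Cayley graph split into \<open>|S|\<close> permutations of its vertices.

  Put \<open>X\<^sub>s = \<Sum>\<^sub>g e\<^bsub>g,s\<^esub>\<close> and \<open>Y\<^sub>s = \<Sum>\<^sub>g e\<^bsub>g,s\<^esub>\<^sup>*\<close>. Since distinct arcs labelled \<open>s\<close> have distinct ranges, the
  relations of the Leavitt path algebra \<open>L\<close> collapse to \<open>Y\<^sub>s X\<^sub>t = \<delta>\<^bsub>s,t\<^esub>\<close> and \<open>\<Sum>\<^sub>s X\<^sub>s Y\<^sub>s = 1\<close>. Hence
  \<open>x \<mapsto> (Y\<^sub>s x)\<^sub>s\<close> is an isomorphism from \<open>L\<close> to \<open>L\<^bsup>|S|\<^esup>\<close>, and it lowers degrees by one because each \<open>Y\<^sub>s\<close> has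
  degree \<open>-1\<close>. It is therefore graded from \<open>L(1)\<close> to \<open>L(0)\<^bsup>|S|\<^esup>\<close>, and gr-IBN forces \<open>|S| = 1\<close>
  (\<open>leavitt_family_rmod_iso\<close>, \<open>gr_IBN_permutation_decomposition\<close>).

  Conversely, if \<open>|S| = 1\<close>, no vertex emits two arcs. For any such graph \<open>L\<close> acts on the vector space
  with basis the vertices: an arc \<open>e\<close> sends its range to its source, \<open>e\<^sup>*\<close> sends the source to the
  range, and a vertex is the projection onto its basis vector. This is a unital homomorphism from
  \<open>L\<close> to a matrix ring over \<open>K\<close>. It carries a matrix of a surjection \<open>L\<^sup>m \<rightarrow> L\<^sup>n\<close> to a
  right invertible block matrix over \<open>K\<close>, so \<open>n \<le> m\<close> by dimension, and IBN follows by symmetry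
  (\<open>rank_condition_if_matrix_rep\<close>, \<open>has_IBN_no_branching\<close>).

  That \<open>|S| = 1\<close> means being a single cycle is elementary: the powers of a generator list the
  vertices of the cycle, and a cycle has as many arcs as vertices, whereas the Cayley graph has
  \<open>|S|\<close> times as many.
\<close>

section \<open>The rank condition\<close>

text \<open>
  The rows of a right invertible matrix are linearly independent, since a linear relation between
  them survives multiplication by the right inverse. They live in a space of dimension \<open>|Q|\<close>.
\<close>
lemma card_le_if_right_invertible:
  fixes A :: "'p \<Rightarrow> 'q \<Rightarrow> 'k::field" and B :: "'q \<Rightarrow> 'p \<Rightarrow> 'k"
  assumes P: "finite P" and Q: "finite Q"
    and AB: "\<And>i j. i \<in> P \<Longrightarrow> j \<in> P \<Longrightarrow> (\<Sum>q\<in>Q. A i q * B q j) = (if i = j then 1 else 0)"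
  shows "card P \<le> card Q"
proof -
  interpret V: vector_space "\<lambda>(c::'k) f. (\<lambda>x::'q. c * f x)"
    by unfold_locales (auto simp: fun_eq_iff algebra_simps)
  have sum_app: "sum F T x = (\<Sum>t\<in>T. F t x)" for F :: "'z \<Rightarrow> 'q \<Rightarrow> 'k" and T x
    by (induction T rule: infinite_finite_induct) auto
  define a where "a i = (\<lambda>q. if q \<in> Q then A i q else 0)" for i
  have a_AB: "(\<Sum>q\<in>Q. a i q * B q j) = (if i = j then 1 else 0)" if "i \<in> P" "j \<in> P" for i j
    using AB[OF that] by (simp add: a_def)
  have inj: "inj_on a P"
  proof (rule inj_onI)
    fix i j assume "i \<in> P" "j \<in> P" "a i = a j"
    then show "i = j" using a_AB[of i j] a_AB[of j j] by (auto split: if_splits)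
  qed
  have "V.independent (a ` P)"
    unfolding V.dependent_finite[OF finite_imageI[OF P]]
  proof clarsimp
    fix u j
    assume 0: "(\<Sum>v\<in>a ` P. (\<lambda>x. u v * v x)) = 0" and j: "j \<in> P" and nz: "u (a j) \<noteq> 0"
    have comb: "(\<Sum>i\<in>P. u (a i) * a i q) = 0" for q
      using fun_cong[OF 0, of q] by (simp add: sum_app sum.reindex[OF inj])
    have "u (a j) = (\<Sum>i\<in>P. u (a i) * (if i = j then 1 else 0))"
      using j P by (simp add: if_distrib[of "\<lambda>x. _ * x"] cong: if_cong)
    also have "\<dots> = (\<Sum>i\<in>P. \<Sum>q\<in>Q. u (a i) * a i q * B q j)"
      by (rule sum.cong) (auto simp: a_AB[OF _ j, symmetric] sum_distrib_left mult.assoc)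
    also have "\<dots> = (\<Sum>q\<in>Q. (\<Sum>i\<in>P. u (a i) * a i q) * B q j)"
      by (subst sum.swap) (simp add: sum_distrib_right)
    finally show False using nz comb by simp
  qed
  moreover have "a ` P \<subseteq> V.span ((\<lambda>q x. if x = q then 1 else 0) ` Q)" (is "_ \<subseteq> V.span (?d ` Q)")
  proof clarify
    fix i assume "i \<in> P"
    have "a i = (\<Sum>q\<in>Q. (\<lambda>x. A i q * ?d q x))"
      using Q by (auto simp: fun_eq_iff sum_app a_def if_distrib[of "\<lambda>x. _ * x"] cong: if_cong)
    also have "\<dots> \<in> V.span (?d ` Q)"
      by (intro V.span_sum V.span_scale V.span_base) auto
    finally show "a i \<in> V.span (?d ` Q)" .
  qed
  ultimately have "card (a ` P) \<le> card (?d ` Q)"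
    using V.independent_span_bound Q by blast
  then show ?thesis
    using card_image[OF inj] card_image_le[OF Q, of ?d] by simp
qed

text \<open>
  Linear maps are needed besides isomorphisms because only surjectivity enters the
  comparison of ranks.
\<close>
definition rmod_lin :: "('a, 'b) ring_scheme \<Rightarrow> ('a, 'm) right_module \<Rightarrow> ('a, 'n) right_module \<Rightarrow>
    ('m \<Rightarrow> 'n) set" where
  "rmod_lin R M N =
    {\<phi> \<in> carrier M \<rightarrow> carrier N.
        (\<forall>x\<in>carrier M. \<forall>y\<in>carrier M. \<phi> (radd M x y) = radd N (\<phi> x) (\<phi> y)) \<and>
        (\<forall>x\<in>carrier M. \<forall>r\<in>carrier R. \<phi> (ract M x r) = ract N (\<phi> x) r)}"

context ring
begin

lemma free_rmod_closed:
  "x \<in> carrier (free_rmod R n) \<Longrightarrow> y \<in> carrier (free_rmod R n) \<Longrightarrow>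
     radd (free_rmod R n) x y \<in> carrier (free_rmod R n)"
  "x \<in> carrier (free_rmod R n) \<Longrightarrow> r \<in> carrier R \<Longrightarrow>
     ract (free_rmod R n) x r \<in> carrier (free_rmod R n)"
  by (auto simp: free_rmod_def)

definition unit_vec :: "nat \<Rightarrow> nat \<Rightarrow> nat \<Rightarrow> 'a" where
  "unit_vec n i = (\<lambda>j\<in>{..<n}. if i = j then \<one> else \<zero>)"

lemma unit_vec_carrier: "unit_vec n i \<in> carrier (free_rmod R n)"
  by (auto simp: free_rmod_def unit_vec_def)

text \<open>
  A vector is the sum of the unit vectors times its entries. As scalars act from the right,
  linearity leaves the entries of the matrix to the left of those of the vector.
\<close>
lemma rmod_lin_eq_matrix:
  assumes \<phi>: "\<phi> \<in> rmod_lin R (free_rmod R m) (free_rmod R n)"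
    and x: "x \<in> carrier (free_rmod R m)" and j: "j < n"
  shows "\<phi> x j = (\<Oplus>i\<in>{..<m}. \<phi> (unit_vec m i) j \<otimes> x i)"
proof -
  have add: "\<phi> (radd (free_rmod R m) y z) = radd (free_rmod R n) (\<phi> y) (\<phi> z)"
    if "y \<in> carrier (free_rmod R m)" "z \<in> carrier (free_rmod R m)" for y z
    using \<phi> that by (auto simp: rmod_lin_def)
  have act: "\<phi> (ract (free_rmod R m) y r) = ract (free_rmod R n) (\<phi> y) r"
    if "y \<in> carrier (free_rmod R m)" "r \<in> carrier R" for y r
    using \<phi> that by (auto simp: rmod_lin_def)
  have cl: "\<phi> y j \<in> carrier R" if "y \<in> carrier (free_rmod R m)" for y
    using \<phi> that j by (auto simp: rmod_lin_def free_rmod_def)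
  have xc: "x i \<in> carrier R" if "i < m" for i
    using x that by (auto simp: free_rmod_def)
  \<comment> \<open>Truncating the vector to its first \<open>l\<close> entries turns the claim into an induction on \<open>l\<close>.\<close>
  define t where "t l = (\<lambda>i\<in>{..<m}. if i < l then x i else \<zero>)" for l
  have tc: "t l \<in> carrier (free_rmod R m)" for l
    using xc by (auto simp: free_rmod_def t_def)
  have "\<phi> (t l) j = (\<Oplus>i\<in>{..<l}. \<phi> (unit_vec m i) j \<otimes> x i)" if "l \<le> m" for l
    using that
  proof (induction l)
    case 0
    have "t 0 = ract (free_rmod R m) (t 0) \<zero>"
      by (auto simp: t_def free_rmod_def fun_eq_iff)
    then have "\<phi> (t 0) = ract (free_rmod R n) (\<phi> (t 0)) \<zero>"
      using act[OF tc zero_closed] by metis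
    then have "\<phi> (t 0) j = \<phi> (t 0) j \<otimes> \<zero>"
      using j by (simp add: free_rmod_def fun_eq_iff) metis
    then show ?case using cl[OF tc] by simp
  next
    case (Suc l)
    then have l: "l < m" by simp
    have "t (Suc l) = radd (free_rmod R m) (ract (free_rmod R m) (unit_vec m l) (x l)) (t l)"
      using xc by (auto simp: t_def free_rmod_def fun_eq_iff unit_vec_def less_Suc_eq l)
    then have "\<phi> (t (Suc l)) j = \<phi> (unit_vec m l) j \<otimes> x l \<oplus> \<phi> (t l) j"
      using j by (simp add: add act tc unit_vec_carrier free_rmod_closed xc l)
        (simp add: free_rmod_def)
    also have "\<dots> = (\<Oplus>i\<in>{..<Suc l}. \<phi> (unit_vec m i) j \<otimes> x i)"
      using Suc l xc cl[OF unit_vec_carrier] by (simp add: lessThan_Suc Pi_def)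
    finally show ?case .
  qed
  moreover have "t m = x"
    using x by (auto simp: t_def free_rmod_def fun_eq_iff PiE_def extensional_def)
  ultimately show ?thesis by (metis order_refl)
qed

text \<open>
  A surjection \<open>R\<^sup>m \<rightarrow> R\<^sup>n\<close> splits, so its matrix has a right inverse over \<open>R\<close>. Replacing every entry by
  its image under \<open>\<rho>\<close> gives a right invertible matrix over the field with \<open>n |I|\<close> rows and \<open>m |I|\<close>
  columns.
\<close>
lemma rank_condition_if_matrix_rep:
  fixes \<rho> :: "'a \<Rightarrow> 'i \<Rightarrow> 'i \<Rightarrow> 'k::field"
  assumes I: "finite I" "I \<noteq> {}"
    and add: "\<And>x y a b. x \<in> carrier R \<Longrightarrow> y \<in> carrier R \<Longrightarrow> a \<in> I \<Longrightarrow> b \<in> I \<Longrightarrow>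
                \<rho> (x \<oplus> y) a b = \<rho> x a b + \<rho> y a b"
    and mult: "\<And>x y a b. x \<in> carrier R \<Longrightarrow> y \<in> carrier R \<Longrightarrow> a \<in> I \<Longrightarrow> b \<in> I \<Longrightarrow>
                \<rho> (x \<otimes> y) a b = (\<Sum>c\<in>I. \<rho> x a c * \<rho> y c b)"
    and one: "\<And>a b. a \<in> I \<Longrightarrow> b \<in> I \<Longrightarrow> \<rho> \<one> a b = (if a = b then 1 else 0)"
    and \<phi>: "\<phi> \<in> rmod_lin R (free_rmod R m) (free_rmod R n)"
    and surj: "carrier (free_rmod R n) \<subseteq> \<phi> ` carrier (free_rmod R m)"
  shows "n \<le> m"
proof -
  have zero: "\<rho> \<zero> a b = 0" if "a \<in> I" "b \<in> I" for a b
    by (metis add that l_zero zero_closed add_cancel_right_right)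
  have \<rho>_sum: "\<rho> (\<Oplus>i\<in>{..<l}. f i) a b = (\<Sum>i<l. \<rho> (f i) a b)"
    if "a \<in> I" "b \<in> I" "\<And>i. i < l \<Longrightarrow> f i \<in> carrier R" for f :: "nat \<Rightarrow> 'a" and l a b
    using that(3)
  proof (induction l)
    case (Suc l)
    then have "(\<Oplus>i\<in>{..<Suc l}. f i) = f l \<oplus> (\<Oplus>i\<in>{..<l}. f i)"
      by (simp add: lessThan_Suc Pi_def)
    with Suc that show ?case by (simp add: add Pi_def)
  qed (simp add: zero that)
  \<comment> \<open>Preimages of the unit vectors are the columns of a right inverse of the matrix of \<open>\<phi>\<close>.\<close>
  have "\<forall>l. \<exists>b \<in> carrier (free_rmod R m). \<phi> b = unit_vec n l"
    using surj unit_vec_carrier by (metis imageE subsetD)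
  then obtain b where b: "\<And>l. b l \<in> carrier (free_rmod R m)" "\<And>l. \<phi> (b l) = unit_vec n l"
    by metis
  have bc: "b l i \<in> carrier R" if "i < m" for l i
    using b(1)[of l] that by (auto simp: free_rmod_def)
  define A where "A j i = \<phi> (unit_vec m i) j" for j i
  have Ac: "A j i \<in> carrier R" if "j < n" for i j
    using \<phi> that unit_vec_carrier[of m i] by (auto simp: A_def rmod_lin_def free_rmod_def)
  have "card ({..<n} \<times> I) \<le> card ({..<m} \<times> I)"
  proof (rule card_le_if_right_invertible)
    fix p q assume pq: "p \<in> {..<n} \<times> I" "q \<in> {..<n} \<times> I"
    obtain j x l y where p: "p = (j, x)" and q: "q = (l, y)" by fastforce
    with pq have jl: "j < n" "l < n" and xy: "x \<in> I" "y \<in> I" by auto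
    have "(\<Oplus>i\<in>{..<m}. A j i \<otimes> b l i) = (if j = l then \<one> else \<zero>)"
      using rmod_lin_eq_matrix[OF \<phi> b(1) jl(1), of l] jl by (auto simp: A_def b(2) unit_vec_def)
    moreover have "\<rho> (if j = l then \<one> else \<zero>) x y = (if j = l \<and> x = y then 1 else 0)"
      by (simp add: one zero xy)
    ultimately have "(\<Sum>i<m. \<rho> (A j i \<otimes> b l i) x y) = (if j = l \<and> x = y then 1 else 0)"
      using \<rho>_sum[OF xy, of m "\<lambda>i. A j i \<otimes> b l i"] jl by (simp add: Ac bc)
    then show "(\<Sum>r\<in>{..<m} \<times> I. (case p of (j, x) \<Rightarrow> \<lambda>(i, z). \<rho> (A j i) x z) r *
                 (case r of (i, z) \<Rightarrow> \<lambda>(l, y). \<rho> (b l i) z y) q) = (if p = q then 1 else 0)"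
      using jl xy by (simp add: p q mult Ac bc sum.cartesian_product case_prod_beta')
  qed (use I in auto)
  then show ?thesis using I by (simp add: card_cartesian_product card_gt_0_iff)
qed

lemma rmod_iso_lin_surj:
  assumes "\<phi> \<in> rmod_iso R M N"
  shows "\<phi> \<in> rmod_lin R M N" "\<phi> ` carrier M = carrier N"
  using assms by (auto simp: rmod_iso_def rmod_lin_def bij_betw_def)

lemma rmod_iso_inv:
  assumes "\<phi> \<in> rmod_iso R (free_rmod R m) (free_rmod R n)"
  shows "inv_into (carrier (free_rmod R m)) \<phi> \<in> rmod_iso R (free_rmod R n) (free_rmod R m)"
proof -
  let ?M = "free_rmod R m" and ?N = "free_rmod R n"
  let ?\<psi> = "inv_into (carrier ?M) \<phi>"
  have bij: "bij_betw \<phi> (carrier ?M) (carrier ?N)"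
    and add: "\<And>x y. x \<in> carrier ?M \<Longrightarrow> y \<in> carrier ?M \<Longrightarrow> \<phi> (radd ?M x y) = radd ?N (\<phi> x) (\<phi> y)"
    and act: "\<And>x r. x \<in> carrier ?M \<Longrightarrow> r \<in> carrier R \<Longrightarrow> \<phi> (ract ?M x r) = ract ?N (\<phi> x) r"
    using assms by (auto simp: rmod_iso_def)
  have \<psi>: "?\<psi> y \<in> carrier ?M" "\<phi> (?\<psi> y) = y" if "y \<in> carrier ?N" for y
    using that bij by (auto simp: bij_betw_def inv_into_into f_inv_into_f)
  have \<psi>I: "?\<psi> y = x" if "x \<in> carrier ?M" "\<phi> x = y" for x y
    using that bij by (auto simp: bij_betw_def)
  show ?thesis
    unfolding rmod_iso_def
    using bij by (auto intro!: \<psi>I simp: add act \<psi> free_rmod_closed bij_betw_inv_into)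
qed

lemma has_IBN_if_matrix_rep:
  fixes \<rho> :: "'a \<Rightarrow> 'i \<Rightarrow> 'i \<Rightarrow> 'k::field"
  assumes I: "finite I" "I \<noteq> {}"
    and add: "\<And>x y a b. x \<in> carrier R \<Longrightarrow> y \<in> carrier R \<Longrightarrow> a \<in> I \<Longrightarrow> b \<in> I \<Longrightarrow>
                \<rho> (x \<oplus> y) a b = \<rho> x a b + \<rho> y a b"
    and mult: "\<And>x y a b. x \<in> carrier R \<Longrightarrow> y \<in> carrier R \<Longrightarrow> a \<in> I \<Longrightarrow> b \<in> I \<Longrightarrow>
                \<rho> (x \<otimes> y) a b = (\<Sum>c\<in>I. \<rho> x a c * \<rho> y c b)"
    and one: "\<And>a b. a \<in> I \<Longrightarrow> b \<in> I \<Longrightarrow> \<rho> \<one> a b = (if a = b then 1 else 0)"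
  shows "has_IBN R"
proof -
  have le: "n \<le> m" if "\<phi> \<in> rmod_iso R (free_rmod R m) (free_rmod R n)" for \<phi> m n
    using rank_condition_if_matrix_rep[of I \<rho>, OF assms] rmod_iso_lin_surj[OF that] by blast
  show ?thesis
    unfolding has_IBN_def using le rmod_iso_inv by (meson all_not_in_conv antisym)
qed


section \<open>Leavitt families\<close>

text \<open>
  The two families of relations say that the column \<open>(Y\<^sub>i)\<close> and the row \<open>(X\<^sub>i)\<close> are mutually inverse
  matrices, of sizes \<open>k \<times> 1\<close> and \<open>1 \<times> k\<close>.
\<close>
lemma leavitt_family_rmod_iso:
  assumes X: "\<And>i. i < k \<Longrightarrow> X i \<in> carrier R" and Y: "\<And>i. i < k \<Longrightarrow> Y i \<in> carrier R"
    and YX: "\<And>i j. i < k \<Longrightarrow> j < k \<Longrightarrow> Y i \<otimes> X j = (if i = j then \<one> else \<zero>)"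
    and XY: "(\<Oplus>i\<in>{..<k}. X i \<otimes> Y i) = \<one>"
  shows "(\<lambda>x. \<lambda>i\<in>{..<k}. Y i \<otimes> x 0) \<in> rmod_iso R (free_rmod R 1) (free_rmod R k)"
proof -
  let ?\<phi> = "\<lambda>x. \<lambda>i\<in>{..<k}. Y i \<otimes> x 0"
  let ?\<psi> = "\<lambda>y. \<lambda>j\<in>{..<1::nat}. \<Oplus>i\<in>{..<k}. X i \<otimes> y i"
  have \<psi>\<phi>: "?\<psi> (?\<phi> x) = x" if x: "x \<in> carrier (free_rmod R 1)" for x
  proof -
    have x0: "x 0 \<in> carrier R" using x by (auto simp: free_rmod_def)
    have "(\<Oplus>i\<in>{..<k}. X i \<otimes> (?\<phi> x) i) = (\<Oplus>i\<in>{..<k}. (X i \<otimes> Y i) \<otimes> x 0)"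
      by (rule finsum_cong') (auto simp: X Y x0 m_assoc)
    also have "\<dots> = x 0"
      using finsum_ldistr[of "{..<k}" "x 0" "\<lambda>i. X i \<otimes> Y i"] by (simp add: x0 X Y XY Pi_def)
    finally show ?thesis
      using x by (auto simp: free_rmod_def fun_eq_iff PiE_def extensional_def)
  qed
  have \<phi>\<psi>: "?\<phi> (?\<psi> y) = y" if y: "y \<in> carrier (free_rmod R k)" for y
  proof -
    have yc: "y i \<in> carrier R" if "i < k" for i using y that by (auto simp: free_rmod_def)
    have "Y j \<otimes> (\<Oplus>i\<in>{..<k}. X i \<otimes> y i) = y j" if j: "j < k" for j
    proof -
      have "Y j \<otimes> (\<Oplus>i\<in>{..<k}. X i \<otimes> y i) = (\<Oplus>i\<in>{..<k}. Y j \<otimes> (X i \<otimes> y i))"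
        by (rule finsum_rdistr) (auto simp: X Y yc j)
      also have "\<dots> = (\<Oplus>i\<in>{..<k}. if j = i then y i else \<zero>)"
        by (rule finsum_cong') (auto simp: X Y yc j m_assoc[symmetric] YX)
      also have "\<dots> = y j"
        by (rule finsum_singleton) (auto simp: j yc)
      finally show ?thesis .
    qed
    then show ?thesis
      using y by (auto simp: free_rmod_def fun_eq_iff PiE_def extensional_def)
  qed
  have "bij_betw ?\<phi> (carrier (free_rmod R 1)) (carrier (free_rmod R k))"
    by (rule bij_betw_byWitness[where f' = ?\<psi>])
      (use \<psi>\<phi> \<phi>\<psi> in \<open>auto simp: free_rmod_def X Y Pi_def PiE_def intro!: finsum_closed\<close>)
  then show ?thesis
    by (auto simp: rmod_iso_def free_rmod_def Y fun_eq_iff r_distr m_assoc PiE_def Pi_def)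
qed

text \<open>
  If all \<open>Y\<^sub>i\<close> are homogeneous of the same degree \<open>-\<delta>\<close>, the isomorphism above is graded from
  \<open>R(\<delta>)\<close> to \<open>R(0)\<^sup>k\<close>.
\<close>
lemma gr_IBN_leavitt_family:
  fixes A :: "'d::ab_group_add \<Rightarrow> 'a set" and k :: nat
  assumes X: "\<And>i. i < k \<Longrightarrow> X i \<in> carrier R" and Y: "\<And>i. i < k \<Longrightarrow> Y i \<in> carrier R"
    and YX: "\<And>i j. i < k \<Longrightarrow> j < k \<Longrightarrow> Y i \<otimes> X j = (if i = j then \<one> else \<zero>)"
    and XY: "(\<Oplus>i\<in>{..<k}. X i \<otimes> Y i) = \<one>"
    and deg: "\<And>i x \<gamma>. i < k \<Longrightarrow> x \<in> A (\<delta> + \<gamma>) \<Longrightarrow> Y i \<otimes> x \<in> A \<gamma>"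
    and k: "k > 0" and gr: "has_gr_IBN R A"
  shows "k = 1"
proof -
  have graded: "\<forall>\<gamma>. (\<lambda>x. \<lambda>i\<in>{..<k}. Y i \<otimes> x 0) ` shift_component A 1 (\<lambda>_. \<delta>) \<gamma>
          \<subseteq> shift_component A k (\<lambda>_. 0) \<gamma>"
  proof (intro allI image_subsetI)
    fix \<gamma> x assume "x \<in> shift_component A 1 (\<lambda>_. \<delta>) \<gamma>"
    then have "x 0 \<in> A (\<delta> + \<gamma>)"
      unfolding shift_component_def by (rule PiE_mem) simp
    then show "(\<lambda>i\<in>{..<k}. Y i \<otimes> x 0) \<in> shift_component A k (\<lambda>_. 0) \<gamma>"
      using deg by (simp add: shift_component_def)
  qed
  have "1 = k"
  proof (rule gr[unfolded has_gr_IBN_def, rule_format, of 1 k "\<lambda>_. \<delta>" "\<lambda>_. 0"])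
    show "\<exists>\<phi>\<in>rmod_iso R (free_rmod R 1) (free_rmod R k).
        \<forall>\<gamma>. \<phi> ` shift_component A 1 (\<lambda>_. \<delta>) \<gamma> \<subseteq> shift_component A k (\<lambda>_. 0) \<gamma>"
      by (rule bexI[where x = "\<lambda>x. \<lambda>i\<in>{..<k}. Y i \<otimes> x 0"])
        (rule graded, rule leavitt_family_rmod_iso[of k X Y, OF X Y YX XY])
  qed (use k in simp_all)
  then show ?thesis ..
qed

end

section \<open>Leavitt path algebras of finite graphs\<close>

text \<open>
  \<open>L\<^sub>K(E)\<close> lies in the quotient of the unital free algebra, but its identity is the sum of the
  vertices rather than the class of the empty word; so it is a subring only up to the unit.
\<close>
lemma (in ring) subring_with_local_unit:
  assumes C: "C \<subseteq> carrier R" and zero: "\<zero> \<in> C" and u: "u \<in> C"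
    and add: "\<And>x y. x \<in> C \<Longrightarrow> y \<in> C \<Longrightarrow> x \<oplus> y \<in> C"
    and minus: "\<And>x. x \<in> C \<Longrightarrow> \<ominus> x \<in> C"
    and mult: "\<And>x y. x \<in> C \<Longrightarrow> y \<in> C \<Longrightarrow> x \<otimes> y \<in> C"
    and unit: "\<And>x. x \<in> C \<Longrightarrow> u \<otimes> x = x" "\<And>x. x \<in> C \<Longrightarrow> x \<otimes> u = x"
  shows "ring (R\<lparr>carrier := C, one := u\<rparr>)"
proof (rule ringI)
  have C': "x \<in> carrier R" if "x \<in> C" for x using C that by blast
  show "abelian_group (R\<lparr>carrier := C, one := u\<rparr>)"
  proof (rule abelian_groupI)
    fix x assume "x \<in> carrier (R\<lparr>carrier := C, one := u\<rparr>)"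
    then show "\<exists>y\<in>carrier (R\<lparr>carrier := C, one := u\<rparr>).
        y \<oplus>\<^bsub>R\<lparr>carrier := C, one := u\<rparr>\<^esub> x = \<zero>\<^bsub>R\<lparr>carrier := C, one := u\<rparr>\<^esub>"
      using C' minus by (auto intro!: bexI[of _ "\<ominus> x"] l_neg)
  qed (use C' zero add in \<open>auto simp: a_ac\<close>)
  show "monoid (R\<lparr>carrier := C, one := u\<rparr>)"
    by (rule monoidI) (use C' u mult unit in \<open>auto simp: m_assoc\<close>)
qed (use C in \<open>auto simp: l_distr r_distr subset_iff\<close>)

lemma sum_in_free_algebra:
  "(\<And>i. i \<in> A \<Longrightarrow> f i \<in> carrier (free_algebra K X)) \<Longrightarrow> sum f A \<in> carrier (free_algebra K X)"
  unfolding free_algebra_def by (auto dest!: keys_sum[THEN subsetD])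

lemma free_algebra_closed:
  "p \<in> carrier (free_algebra K X) \<Longrightarrow> q \<in> carrier (free_algebra K X) \<Longrightarrow>
     p + q \<in> carrier (free_algebra K X)"
  "p \<in> carrier (free_algebra K X) \<Longrightarrow> q \<in> carrier (free_algebra K X) \<Longrightarrow>
     p - q \<in> carrier (free_algebra K X)"
  "p \<in> carrier (free_algebra K X) \<Longrightarrow> - p \<in> carrier (free_algebra K X)"
  "p \<in> carrier (free_algebra K X) \<Longrightarrow> q \<in> carrier (free_algebra K X) \<Longrightarrow>
     p * q \<in> carrier (free_algebra K X)"
  "0 \<in> carrier (free_algebra K X)"
  "1 \<in> carrier (free_algebra K X)"
  "x \<in> X \<Longrightarrow> gen x \<in> carrier (free_algebra K X)"
  "set xs \<subseteq> X \<Longrightarrow> Poly_Mapping.single (Word xs) c \<in> carrier (free_algebra K X)"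
  using keys_add[of p q] keys_diff[of p q] keys_mult[of p q]
  by (auto simp: free_algebra_def gen_def plus_word_def zero_word_def; fastforce)+

lemma free_algebra_simps:
  "mult (free_algebra K X) = (*)" "add (free_algebra K X) = (+)"
  "zero (free_algebra K X) = 0" "one (free_algebra K X) = 1"
  by (simp_all add: free_algebra_def)

lemma ring_free_algebra: "ring (free_algebra K X)"
proof (rule ringI)
  show "abelian_group (free_algebra K X)"
  proof (rule abelian_groupI)
    fix p assume "p \<in> carrier (free_algebra K X)"
    then show "\<exists>q\<in>carrier (free_algebra K X).
        q \<oplus>\<^bsub>free_algebra K X\<^esub> p = \<zero>\<^bsub>free_algebra K X\<^esub>"
      by (auto simp: free_algebra_simps free_algebra_closed intro!: bexI[of _ "- p"])
  qed (auto simp: free_algebra_simps free_algebra_closed add_ac)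
  show "monoid (free_algebra K X)"
    by (rule monoidI) (auto simp: free_algebra_simps free_algebra_closed mult.assoc)
qed (auto simp: free_algebra_simps distrib_left distrib_right)

lemma free_algebra_a_minus:
  assumes "p \<in> carrier (free_algebra K X)" "q \<in> carrier (free_algebra K X)"
  shows "p \<ominus>\<^bsub>free_algebra K X\<^esub> q = p - q"
proof -
  interpret ring "free_algebra K X" by (rule ring_free_algebra)
  have "\<ominus>\<^bsub>free_algebra K X\<^esub> q = - q"
    by (rule minus_equality) (auto simp: free_algebra_simps free_algebra_closed assms)
  then show ?thesis by (simp add: a_minus_def free_algebra_simps)
qed

lemma poly_mapping_sum_singles:
  "p = (\<Sum>w\<in>Poly_Mapping.keys p. Poly_Mapping.single w (Poly_Mapping.lookup p w))"
  by (rule poly_mapping_eqI) (auto simp: lookup_sum lookup_single when_def in_keys_iff)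

lemma word_plus_eq_0 [simp]: "(v::'x word) + w = 0 \<longleftrightarrow> v = 0 \<and> w = 0"
  by (cases v; cases w) (auto simp: plus_word_def zero_word_def)

lemma lookup_mult_0:
  fixes p q :: "'x word \<Rightarrow>\<^sub>0 'k::field"
  assumes "Poly_Mapping.lookup p 0 = 0"
  shows "Poly_Mapping.lookup (p * q) 0 = 0"
proof -
  have "0 \<notin> Poly_Mapping.keys (p * q)"
  proof
    assume "0 \<in> Poly_Mapping.keys (p * q)"
    then obtain a b where "0 = a + b" "a \<in> Poly_Mapping.keys p"
      using keys_mult[of p q] by blast
    then show False using assms by (metis in_keys_iff word_plus_eq_0)
  qed
  then show ?thesis by (simp add: in_keys_iff)
qed

lemma lookup_gen_0 [simp]: "Poly_Mapping.lookup (gen x) 0 = 0"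
  by (simp add: gen_def lookup_single zero_word_def when_def)

locale leavitt_fin_digraph = fin_digraph E
  for E :: "('v, 'e) pre_digraph" and K :: "'k::field itself"
begin

abbreviation "P \<equiv> free_algebra K (lpa_gens E)"
abbreviation "L \<equiv> leavitt K E"
abbreviation "cls \<equiv> lpa_class K E"
abbreviation "vertex v \<equiv> (gen (Vertex v) :: ('v, 'e) lpa_gen word \<Rightarrow>\<^sub>0 'k)"
abbreviation "edge e \<equiv> (gen (Edge e) :: ('v, 'e) lpa_gen word \<Rightarrow>\<^sub>0 'k)"
abbreviation "ghost e \<equiv> (gen (Ghost e) :: ('v, 'e) lpa_gen word \<Rightarrow>\<^sub>0 'k)"

definition unit_poly :: "('v, 'e) lpa_gen word \<Rightarrow>\<^sub>0 'k" where
  "unit_poly = (\<Sum>v\<in>verts E. vertex v)"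

lemma gens_closed [simp]:
  "v \<in> verts E \<Longrightarrow> vertex v \<in> carrier P"
  "e \<in> arcs E \<Longrightarrow> edge e \<in> carrier P"
  "e \<in> arcs E \<Longrightarrow> ghost e \<in> carrier P"
  by (auto intro!: free_algebra_closed simp: lpa_gens_def)

lemmas [simp] = free_algebra_closed(1-6) sum_in_free_algebra

lemma unit_poly_closed [simp]: "unit_poly \<in> carrier P"
  by (simp add: unit_poly_def)

lemma relators_closed: "lpa_relators K E \<subseteq> carrier P"
  unfolding lpa_relators_def
  by (auto intro!: free_algebra_closed(1-6) sum_in_free_algebra gens_closed
      simp: regular_vertex_def out_arcs_def)

lemma ideal_lpa: "ideal (lpa_ideal K E) P"
  unfolding lpa_ideal_def by (intro ring.genideal_ideal ring_free_algebra relators_closed)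

lemma cls_eq_iff:
  "p \<in> carrier P \<Longrightarrow> q \<in> carrier P \<Longrightarrow> cls p = cls q \<longleftrightarrow> p - q \<in> lpa_ideal K E"
  using ring.quotient_eq_iff_same_a_r_cos[OF ring_free_algebra ideal_lpa, of p q]
  by (simp add: lpa_class_def free_algebra_a_minus)

text \<open>
  Computations in \<open>L\<close> take place between representing polynomials, with \<open>cls p = cls q\<close> as the
  congruence modulo the relations.
\<close>
lemma relator_cls_eq:
  assumes "p - q \<in> lpa_relators K E" "p \<in> carrier P" "q \<in> carrier P"
  shows "cls p = cls q"
  using assms ring.genideal_self[OF ring_free_algebra relators_closed]
  by (auto simp: cls_eq_iff lpa_ideal_def)

lemma L_mult: "p \<in> carrier P \<Longrightarrow> q \<in> carrier P \<Longrightarrow> cls p \<otimes>\<^bsub>L\<^esub> cls q = cls (p * q)"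
  and L_add: "p \<in> carrier P \<Longrightarrow> q \<in> carrier P \<Longrightarrow> cls p \<oplus>\<^bsub>L\<^esub> cls q = cls (p + q)"
  and L_zero: "\<zero>\<^bsub>L\<^esub> = cls 0"
  and L_one: "\<one>\<^bsub>L\<^esub> = cls unit_poly"
proof -
  interpret I: ideal "lpa_ideal K E" P by (rule ideal_lpa)
  show "p \<in> carrier P \<Longrightarrow> q \<in> carrier P \<Longrightarrow> cls p \<otimes>\<^bsub>L\<^esub> cls q = cls (p * q)"
    using I.rcoset_mult_add[of p q]
    by (simp add: leavitt_def FactRing_simps lpa_class_def free_algebra_simps)
  show "p \<in> carrier P \<Longrightarrow> q \<in> carrier P \<Longrightarrow> cls p \<oplus>\<^bsub>L\<^esub> cls q = cls (p + q)"
    using I.a_rcos_sum[of p q]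
    by (simp add: leavitt_def FactRing_simps lpa_class_def free_algebra_simps)
  show "\<zero>\<^bsub>L\<^esub> = cls 0"
    using I.a_coset_add_zero[OF I.a_subset]
    by (simp add: leavitt_def FactRing_simps lpa_class_def free_algebra_simps)
  show "\<one>\<^bsub>L\<^esub> = cls unit_poly"
    by (simp add: leavitt_def unit_poly_def)
qed

lemma carrier_L: "carrier L = cls ` {p \<in> carrier P. Poly_Mapping.lookup p 0 = 0}"
  by (simp add: leavitt_def)

lemma cls_add_cong:
  assumes "cls p = cls p'" "cls q = cls q'"
    and "p \<in> carrier P" "p' \<in> carrier P" "q \<in> carrier P" "q' \<in> carrier P"
  shows "cls (p + q) = cls (p' + q')"
  using assms by (metis L_add)

lemma cls_mult_cong:
  assumes "cls p = cls p'" "cls q = cls q'"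
    and "p \<in> carrier P" "p' \<in> carrier P" "q \<in> carrier P" "q' \<in> carrier P"
  shows "cls (p * q) = cls (p' * q')"
  using assms by (metis L_mult)

lemma cls_sum_cong:
  assumes "\<And>i. i \<in> A \<Longrightarrow> cls (f i) = cls (g i)"
    and "\<And>i. i \<in> A \<Longrightarrow> f i \<in> carrier P" "\<And>i. i \<in> A \<Longrightarrow> g i \<in> carrier P"
  shows "cls (sum f A) = cls (sum g A)"
  using assms
proof (induction A rule: infinite_finite_induct)
  case (insert i A)
  then show ?case by (simp, intro cls_add_cong) auto
qed auto

lemma lpa_relations:
  "v \<in> verts E \<Longrightarrow> w \<in> verts E \<Longrightarrow>
     cls (vertex v * vertex w) = cls (if v = w then vertex w else 0)"
  "e \<in> arcs E \<Longrightarrow> cls (vertex (tail E e) * edge e) = cls (edge e)"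
  "e \<in> arcs E \<Longrightarrow> cls (edge e * vertex (head E e)) = cls (edge e)"
  "e \<in> arcs E \<Longrightarrow> cls (vertex (head E e) * ghost e) = cls (ghost e)"
  "e \<in> arcs E \<Longrightarrow> cls (ghost e * vertex (tail E e)) = cls (ghost e)"
  "e \<in> arcs E \<Longrightarrow> f \<in> arcs E \<Longrightarrow>
     cls (ghost e * edge f) = cls (if e = f then vertex (head E e) else 0)"
  "regular_vertex E v \<Longrightarrow> cls (vertex v) = cls (\<Sum>e\<in>out_arcs E v. edge e * ghost e)"
proof -
  note rel = lpa_relators_def[of K E]
  show "v \<in> verts E \<Longrightarrow> w \<in> verts E \<Longrightarrow>
     cls (vertex v * vertex w) = cls (if v = w then vertex w else 0)"
    by (rule relator_cls_eq, unfold rel, blast, auto)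
  show "e \<in> arcs E \<Longrightarrow> cls (vertex (tail E e) * edge e) = cls (edge e)"
    by (rule relator_cls_eq, unfold rel, blast, auto)
  show "e \<in> arcs E \<Longrightarrow> cls (edge e * vertex (head E e)) = cls (edge e)"
    by (rule relator_cls_eq, unfold rel, blast, auto)
  show "e \<in> arcs E \<Longrightarrow> cls (vertex (head E e) * ghost e) = cls (ghost e)"
    by (rule relator_cls_eq, unfold rel, blast, auto)
  show "e \<in> arcs E \<Longrightarrow> cls (ghost e * vertex (tail E e)) = cls (ghost e)"
    by (rule relator_cls_eq, unfold rel, blast, auto)
  show "e \<in> arcs E \<Longrightarrow> f \<in> arcs E \<Longrightarrow>
     cls (ghost e * edge f) = cls (if e = f then vertex (head E e) else 0)"
    by (rule relator_cls_eq, unfold rel, blast, auto)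
  show "regular_vertex E v \<Longrightarrow> cls (vertex v) = cls (\<Sum>e\<in>out_arcs E v. edge e * ghost e)"
    by (rule relator_cls_eq, unfold rel, blast,
        auto simp: out_arcs_def regular_vertex_def intro!: sum_in_free_algebra)
qed

lemma unit_mult_gen:
  assumes "x \<in> lpa_gens E"
  shows "cls (unit_poly * gen x) = cls (gen x)" "cls (gen x * unit_poly) = cls (gen x)"
proof -
  have V: "cls (unit_poly * vertex w) = cls (vertex w)" "cls (vertex w * unit_poly) = cls (vertex w)"
    if w: "w \<in> verts E" for w
  proof -
    have "cls (unit_poly * vertex w) = cls (\<Sum>v\<in>verts E. if v = w then vertex w else 0)"
      unfolding unit_poly_def sum_distrib_right
      by (rule cls_sum_cong) (auto simp: w lpa_relations)
    then show "cls (unit_poly * vertex w) = cls (vertex w)" using w by simp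
    have "cls (vertex w * unit_poly) = cls (\<Sum>v\<in>verts E. if w = v then vertex v else 0)"
      unfolding unit_poly_def sum_distrib_left
      by (rule cls_sum_cong) (auto simp: w lpa_relations)
    then show "cls (vertex w * unit_poly) = cls (vertex w)" using w by simp
  qed
  have left: "cls (unit_poly * p) = cls p"
    if "w \<in> verts E" "p \<in> carrier P" "cls (vertex w * p) = cls p" for w p
  proof -
    have "cls (unit_poly * p) = cls (unit_poly * (vertex w * p))"
      by (rule cls_mult_cong) (use that in auto)
    also have "\<dots> = cls ((unit_poly * vertex w) * p)" by (simp add: mult.assoc)
    also have "\<dots> = cls (vertex w * p)"
      by (rule cls_mult_cong) (use that V in auto)
    finally show ?thesis using that by simp
  qed
  have right: "cls (p * unit_poly) = cls p"
    if "w \<in> verts E" "p \<in> carrier P" "cls (p * vertex w) = cls p" for w p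
  proof -
    have "cls (p * unit_poly) = cls ((p * vertex w) * unit_poly)"
      by (rule cls_mult_cong) (use that in auto)
    also have "\<dots> = cls (p * (vertex w * unit_poly))" by (simp add: mult.assoc)
    also have "\<dots> = cls (p * vertex w)"
      by (rule cls_mult_cong) (use that V in auto)
    finally show ?thesis using that by simp
  qed
  show "cls (unit_poly * gen x) = cls (gen x)" "cls (gen x * unit_poly) = cls (gen x)"
    using assms V left[OF tail_in_verts gens_closed(2) lpa_relations(2)]
      left[OF head_in_verts gens_closed(3) lpa_relations(4)]
      right[OF head_in_verts gens_closed(2) lpa_relations(3)]
      right[OF tail_in_verts gens_closed(3) lpa_relations(5)]
    by (auto simp: lpa_gens_def)
qed

text \<open>
  The sum of the vertices fixes every letter, hence every nonempty word through its first
  or last letter. The empty word is excluded by the missing constant term.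
\<close>
lemma unit_mult:
  assumes p: "p \<in> carrier P" and p0: "Poly_Mapping.lookup p 0 = 0"
  shows "cls (unit_poly * p) = cls p" "cls (p * unit_poly) = cls p"
proof -
  have word: "cls (unit_poly * Poly_Mapping.single w c) = cls (Poly_Mapping.single w c)"
       "cls (Poly_Mapping.single w c * unit_poly) = cls (Poly_Mapping.single w c)"
       "Poly_Mapping.single w c \<in> carrier P"
    if w: "w \<in> Poly_Mapping.keys p" for w and c :: 'k
  proof -
    obtain xs where xs: "w = Word xs" by (cases w)
    have "xs \<noteq> []" using w p0 by (auto simp: xs zero_word_def[symmetric] in_keys_iff)
    have X: "set xs \<subseteq> lpa_gens E" using w p by (fastforce simp: free_algebra_def xs)
    then show [simp]: "Poly_Mapping.single w c \<in> carrier P"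
      by (simp add: xs free_algebra_closed)
    obtain x ys where x: "xs = x # ys" using \<open>xs \<noteq> []\<close> by (cases xs) auto
    have s: "Poly_Mapping.single w c = gen x * Poly_Mapping.single (Word ys) c"
      by (simp add: gen_def mult_single xs x plus_word_def)
    have "cls ((unit_poly * gen x) * Poly_Mapping.single (Word ys) c)
            = cls (gen x * Poly_Mapping.single (Word ys) c)"
      by (rule cls_mult_cong) (use X x in \<open>auto simp: unit_mult_gen free_algebra_closed\<close>)
    then show "cls (unit_poly * Poly_Mapping.single w c) = cls (Poly_Mapping.single w c)"
      by (simp add: s mult.assoc)
    obtain y zs where y: "xs = zs @ [y]" using \<open>xs \<noteq> []\<close> by (cases xs rule: rev_cases) auto
    have s: "Poly_Mapping.single w c = Poly_Mapping.single (Word zs) c * gen y"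
      by (simp add: gen_def mult_single xs y plus_word_def)
    have "cls (Poly_Mapping.single (Word zs) c * (gen y * unit_poly))
            = cls (Poly_Mapping.single (Word zs) c * gen y)"
      by (rule cls_mult_cong) (use X y in \<open>auto simp: unit_mult_gen free_algebra_closed\<close>)
    then show "cls (Poly_Mapping.single w c * unit_poly) = cls (Poly_Mapping.single w c)"
      by (simp add: s mult.assoc)
  qed
  let ?s = "\<lambda>w. Poly_Mapping.single w (Poly_Mapping.lookup p w)"
  have "cls (\<Sum>w\<in>Poly_Mapping.keys p. unit_poly * ?s w) = cls (\<Sum>w\<in>Poly_Mapping.keys p. ?s w)"
    by (rule cls_sum_cong) (auto simp: word)
  then show "cls (unit_poly * p) = cls p"
    by (simp flip: sum_distrib_left poly_mapping_sum_singles)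
  have "cls (\<Sum>w\<in>Poly_Mapping.keys p. ?s w * unit_poly) = cls (\<Sum>w\<in>Poly_Mapping.keys p. ?s w)"
    by (rule cls_sum_cong) (auto simp: word)
  then show "cls (p * unit_poly) = cls p"
    by (simp flip: sum_distrib_right poly_mapping_sum_singles)
qed

lemma cls_in_L:
  "p \<in> carrier P \<Longrightarrow> Poly_Mapping.lookup p 0 = 0 \<Longrightarrow> cls p \<in> carrier L"
  by (auto simp: carrier_L)

lemma ring_L: "ring L"
proof -
  interpret I: ideal "lpa_ideal K E" P by (rule ideal_lpa)
  let ?Q = "P Quot lpa_ideal K E" and ?C = "carrier L"
  interpret Q: ring ?Q by (rule I.quotient_is_ring)
  have op: "x \<otimes>\<^bsub>?Q\<^esub> y = x \<otimes>\<^bsub>L\<^esub> y" "x \<oplus>\<^bsub>?Q\<^esub> y = x \<oplus>\<^bsub>L\<^esub> y" "\<zero>\<^bsub>?Q\<^esub> = \<zero>\<^bsub>L\<^esub>" for x y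
    by (simp_all add: leavitt_def)
  have in_Q: "cls p \<in> carrier ?Q" if "p \<in> carrier P" for p
    using that I.a_rcosetsI[OF I.a_subset] by (simp add: FactRing_simps lpa_class_def)
  have minus: "\<ominus>\<^bsub>?Q\<^esub> cls p = cls (- p)" if "p \<in> carrier P" for p
    by (rule Q.minus_equality) (use that in \<open>auto simp: op L_add L_zero in_Q\<close>)
  have u0: "Poly_Mapping.lookup unit_poly 0 = 0" by (simp add: unit_poly_def lookup_sum)
  have "ring (?Q\<lparr>carrier := ?C, one := cls unit_poly\<rparr>)"
  proof (rule Q.subring_with_local_unit)
    show "?C \<subseteq> carrier ?Q" by (auto simp: carrier_L in_Q)
    show "\<zero>\<^bsub>?Q\<^esub> \<in> ?C" "cls unit_poly \<in> ?C" by (auto simp: op L_zero cls_in_L u0)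
  qed (auto simp: carrier_L minus op L_add L_mult unit_mult lookup_add lookup_mult_0
        intro!: imageI)
  then show ?thesis by (simp add: leavitt_def unit_poly_def)
qed

end


section \<open>Graphs without branching\<close>

text \<open>The linear extension of a function on words to the free algebra.\<close>
definition word_sum :: "('x word \<Rightarrow> 'k) \<Rightarrow> ('x word \<Rightarrow>\<^sub>0 'k::field) \<Rightarrow> 'k" where
  "word_sum f p = (\<Sum>w\<in>Poly_Mapping.keys p. Poly_Mapping.lookup p w * f w)"

lemma word_sum_superset:
  "finite W \<Longrightarrow> Poly_Mapping.keys p \<subseteq> W \<Longrightarrow>
     word_sum f p = (\<Sum>w\<in>W. Poly_Mapping.lookup p w * f w)"
  unfolding word_sum_def by (rule sum.mono_neutral_left) (auto simp: in_keys_iff)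

lemma word_sum_add: "word_sum f (p + q) = word_sum f p + word_sum f q"
  using word_sum_superset[of "Poly_Mapping.keys p \<union> Poly_Mapping.keys q" p f]
    word_sum_superset[of "Poly_Mapping.keys p \<union> Poly_Mapping.keys q" q f]
    word_sum_superset[OF _ keys_add[of p q], of f]
  by (simp add: lookup_add distrib_right sum.distrib)

lemma word_sum_0: "word_sum f 0 = 0"
  by (simp add: word_sum_def)

lemma word_sum_diff: "word_sum f (p - q) = word_sum f p - word_sum f q"
  using word_sum_add[of f "p - q" q] by simp

lemma word_sum_sum: "word_sum f (sum g A) = (\<Sum>i\<in>A. word_sum f (g i))"
  by (induction A rule: infinite_finite_induct) (auto simp: word_sum_0 word_sum_add)

lemma word_sum_single: "word_sum f (Poly_Mapping.single w c) = c * f w"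
  by (simp add: word_sum_def)

lemma word_sum_mult:
  "word_sum f (p * q) = (\<Sum>v\<in>Poly_Mapping.keys p. \<Sum>w\<in>Poly_Mapping.keys q.
     Poly_Mapping.lookup p v * Poly_Mapping.lookup q w * f (v + w))"
  by (subst poly_mapping_sum_singles[of p], subst poly_mapping_sum_singles[of q])
    (simp add: sum_product word_sum_sum mult_single word_sum_single)

context leavitt_fin_digraph
begin

text \<open>
  In the representation on the space with basis the vertices, every letter sends a basis vector
  to a basis vector or to zero; so a word is just a partial function on vertices, with \<open>None\<close>
  standing for zero. Words act from the left: the last letter acts first.
\<close>
fun letter_act :: "('v, 'e) lpa_gen \<Rightarrow> 'v \<Rightarrow> 'v option" where
  "letter_act (Vertex v) a = (if v \<in> verts E \<and> a = v then Some v else None)"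
| "letter_act (Edge e) a = (if e \<in> arcs E \<and> a = head E e then Some (tail E e) else None)"
| "letter_act (Ghost e) a = (if e \<in> arcs E \<and> a = tail E e then Some (head E e) else None)"

definition word_act :: "('v, 'e) lpa_gen word \<Rightarrow> 'v \<Rightarrow> 'v option" where
  "word_act w a = foldr (\<lambda>x b. Option.bind b (letter_act x)) (letters w) (Some a)"

lemma letter_act_in_verts: "letter_act x a = Some b \<Longrightarrow> b \<in> verts E"
  by (cases x) (auto split: if_splits)

lemma word_act_in_verts: "a \<in> verts E \<Longrightarrow> word_act w a = Some b \<Longrightarrow> b \<in> verts E"
  unfolding word_act_def
  by (cases "letters w") (auto simp: bind_eq_Some_conv letter_act_in_verts)

lemma word_act_plus: "word_act (v + w) a = Option.bind (word_act w a) (word_act v)"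
proof -
  have "foldr (\<lambda>x b. Option.bind b (letter_act x)) xs c
      = Option.bind c (\<lambda>a. foldr (\<lambda>x b. Option.bind b (letter_act x)) xs (Some a))" for xs c
    by (cases c; induction xs) auto
  from this[of "letters v" "word_act w a"] show ?thesis
    by (simp add: word_act_def[abs_def] plus_word_def)
qed

text \<open>The matrix of a polynomial in the basis of vertices, \<open>a\<close> being the row and \<open>b\<close> the column.\<close>
definition rep :: "(('v, 'e) lpa_gen word \<Rightarrow>\<^sub>0 'k) \<Rightarrow> 'v \<Rightarrow> 'v \<Rightarrow> 'k" where
  "rep p a b = word_sum (\<lambda>w. of_bool (word_act w b = Some a)) p"

lemma rep_mult:
  assumes "b \<in> verts E"
  shows "rep (p * q) a b = (\<Sum>c\<in>verts E. rep p a c * rep q c b)"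
proof -
  have *: "(of_bool (word_act (v + w) b = Some a) :: 'k)
          = (\<Sum>c\<in>verts E. of_bool (word_act v c = Some a) * of_bool (word_act w b = Some c))" for v w
    using word_act_in_verts[OF assms, of w]
    by (cases "word_act w b") (auto simp: word_act_plus of_bool_def if_distrib[of "\<lambda>x. _ * x"] cong: if_cong)
  have "rep (p * q) a b = (\<Sum>v\<in>Poly_Mapping.keys p. \<Sum>w\<in>Poly_Mapping.keys q. \<Sum>c\<in>verts E.
      Poly_Mapping.lookup p v * Poly_Mapping.lookup q w *
        (of_bool (word_act v c = Some a) * of_bool (word_act w b = Some c)))"
    unfolding rep_def word_sum_mult * sum_distrib_left ..
  also have "\<dots> = (\<Sum>c\<in>verts E. \<Sum>v\<in>Poly_Mapping.keys p. \<Sum>w\<in>Poly_Mapping.keys q.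
      Poly_Mapping.lookup p v * Poly_Mapping.lookup q w *
        (of_bool (word_act v c = Some a) * of_bool (word_act w b = Some c)))"
    by (simp add: sum.swap[of _ "verts E"])
  also have "\<dots> = (\<Sum>c\<in>verts E. rep p a c * rep q c b)"
    unfolding rep_def word_sum_def sum_product by (simp only: mult_ac)
  finally show ?thesis .
qed

lemma rep_word1: "rep (gen x) a b = of_bool (letter_act x b = Some a)"
  by (simp add: rep_def gen_def word_sum_single word_act_def)

lemma rep_word2:
  "rep (gen x * gen y) a b = of_bool (Option.bind (letter_act y b) (letter_act x) = Some a)"
  by (simp add: rep_def gen_def mult_single word_sum_single word_act_def plus_word_def)

lemma rep_linear:
  "rep (p + q) a b = rep p a b + rep q a b"
  "rep (p - q) a b = rep p a b - rep q a b"
  "rep 0 a b = 0"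
  "rep (sum f A) a b = (\<Sum>i\<in>A. rep (f i) a b)"
  by (simp_all add: rep_def word_sum_add word_sum_diff word_sum_0 word_sum_sum)

text \<open>
  Absence of branching enters in two relations. If \<open>e \<noteq> f\<close>, then \<open>e\<^sup>* f\<close> acts as zero only
  because \<open>e\<close> and \<open>f\<close> start at different vertices. And \<open>e e\<^sup>*\<close> acts as the whole projection onto the
  source of \<open>e\<close>, so the sum over the arcs that leave a regular vertex must have a single term.
\<close>
lemma rep_relator:
  assumes inj: "inj_on (tail E) (arcs E)" and r: "r \<in> lpa_relators K E"
  shows "rep r a b = 0"
proof -
  have out: "out_arcs E (tail E e) = {e}" if "e \<in> arcs E" for e
    using inj that by (auto simp: out_arcs_def inj_on_def)
  have CK: "rep (vertex v - (\<Sum>e\<in>out_arcs E v. edge e * ghost e)) a b = 0"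
    if v: "regular_vertex E v" for v
  proof -
    obtain e where e: "e \<in> arcs E" "v = tail E e"
      using v by (auto simp: regular_vertex_def out_arcs_def)
    then show ?thesis using out by (simp add: rep_linear rep_word1 rep_word2)
  qed
  show ?thesis
    using r CK inj unfolding lpa_relators_def
    by (auto simp: rep_linear rep_word1 rep_word2 dest: inj_onD)
qed

lemma rep_lpa_ideal:
  assumes inj: "inj_on (tail E) (arcs E)" and p: "p \<in> lpa_ideal K E" "a \<in> verts E" "b \<in> verts E"
  shows "rep p a b = 0"
proof -
  interpret ring P by (rule ring_free_algebra)
  let ?N = "{p \<in> carrier P. \<forall>a\<in>verts E. \<forall>b\<in>verts E. rep p a b = 0}"
  have "ideal ?N P"
  proof (rule idealI)
    show "subgroup ?N (add_monoid P)"
    proof (rule add.subgroupI)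
      fix p assume p: "p \<in> ?N"
      then have "\<ominus>\<^bsub>P\<^esub> p = 0 - p"
        by (intro minus_equality) (auto simp: free_algebra_simps)
      then show "\<ominus>\<^bsub>P\<^esub> p \<in> ?N"
        using p by (auto simp: rep_linear simp del: diff_0)
    qed (auto simp: free_algebra_simps rep_linear intro!: exI[of _ 0])
  qed (auto simp: free_algebra_simps rep_mult ring_free_algebra)
  moreover have "lpa_relators K E \<subseteq> ?N"
    using relators_closed rep_relator[OF inj] by auto
  ultimately have "lpa_ideal K E \<subseteq> ?N"
    unfolding lpa_ideal_def by (rule genideal_minimal)
  then show ?thesis using p by blast
qed

theorem has_IBN_no_branching:
  assumes inj: "inj_on (tail E) (arcs E)" and ne: "verts E \<noteq> {}"
  shows "has_IBN L"
proof -
  \<comment> \<open>The choice of representative is immaterial on vertices, as \<open>rep\<close> vanishes there on the ideal.\<close>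
  define \<rho> where "\<rho> X = rep (SOME p. p \<in> carrier P \<and> X = cls p)" for X
  have \<rho>_cls: "\<rho> (cls p) a b = rep p a b"
    if "p \<in> carrier P" "a \<in> verts E" "b \<in> verts E" for p a b
  proof -
    define q where "q = (SOME q. q \<in> carrier P \<and> cls p = cls q)"
    have "q \<in> carrier P \<and> cls p = cls q" unfolding q_def
      by (rule someI[of _ p]) (use that in auto)
    then have "rep (p - q) a b = 0" using that
      by (intro rep_lpa_ideal[OF inj]) (auto simp flip: cls_eq_iff)
    then show ?thesis by (simp add: \<rho>_def rep_linear flip: q_def)
  qed
  show ?thesis
  proof (rule ring.has_IBN_if_matrix_rep[OF ring_L, of "verts E" \<rho>])
    fix a b assume ab: "a \<in> verts E" "b \<in> verts E"
    have "rep (vertex v) a b = (if v = b then of_bool (a = b) else 0)" if "v \<in> verts E" for v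
      using that by (auto simp: rep_word1)
    then show "\<rho> \<one>\<^bsub>L\<^esub> a b = (if a = b then 1 else 0)"
      using ab \<rho>_cls[OF unit_poly_closed ab] by (simp add: L_one unit_poly_def rep_linear)
    fix x y assume "x \<in> carrier L" "y \<in> carrier L"
    then obtain p q where "p \<in> carrier P" "x = cls p" "q \<in> carrier P" "y = cls q"
      by (auto simp: carrier_L)
    with ab show "\<rho> (x \<oplus>\<^bsub>L\<^esub> y) a b = \<rho> x a b + \<rho> y a b"
      "\<rho> (x \<otimes>\<^bsub>L\<^esub> y) a b = (\<Sum>c\<in>verts E. \<rho> x a c * \<rho> y c b)"
      by (simp_all add: L_add L_mult \<rho>_cls rep_linear rep_mult)
  qed (use ne in auto)
qed


section \<open>Graphs that decompose into permutations of the vertices\<close>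

lemma cls_finsum:
  assumes "finite A" "\<And>i. i \<in> A \<Longrightarrow> f i \<in> carrier P"
    and "\<And>i. i \<in> A \<Longrightarrow> Poly_Mapping.lookup (f i) 0 = 0"
  shows "(\<Oplus>\<^bsub>L\<^esub>i\<in>A. cls (f i)) = cls (\<Sum>i\<in>A. f i)"
proof -
  interpret ring L by (rule ring_L)
  show ?thesis using assms
    by (induction A) (auto simp: L_zero L_add cls_in_L Pi_def)
qed

text \<open>The orthogonal vertices \<open>r(e)\<close> and \<open>r(f)\<close> can be inserted between \<open>e\<close> and \<open>f\<^sup>*\<close>.\<close>
lemma edge_mult_ghost_distinct_heads:
  assumes "e \<in> arcs E" "f \<in> arcs E" "head E e \<noteq> head E f"
  shows "cls (edge e * ghost f) = cls 0"
proof -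
  have "cls (edge e * ghost f)
      = cls ((edge e * vertex (head E e)) * (vertex (head E f) * ghost f))"
    by (rule cls_mult_cong) (use assms in \<open>auto simp: lpa_relations\<close>)
  also have "\<dots> = cls (edge e * (vertex (head E e) * vertex (head E f)) * ghost f)"
    by (simp add: mult.assoc)
  also have "\<dots> = cls (edge e * 0 * ghost f)"
    by (intro cls_mult_cong) (use assms in \<open>auto simp: lpa_relations\<close>)
  finally show ?thesis by simp
qed

lemma ghost_sum_mult_component:
  assumes F: "F \<subseteq> arcs E" and x: "x \<in> leavitt_component K E (1 + d)"
  shows "cls (\<Sum>e\<in>F. ghost e) \<otimes>\<^bsub>L\<^esub> x \<in> leavitt_component K E d"
proof -
  let ?g = "\<Sum>e\<in>F. ghost e"
  have g: "?g \<in> carrier P" "Poly_Mapping.lookup ?g 0 = 0"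
    using F by (auto simp: lookup_sum intro!: sum_in_free_algebra)
  obtain p where p: "x = cls p" "p \<in> carrier P"
    and deg: "\<And>w. w \<in> Poly_Mapping.keys p \<Longrightarrow> word_degree w = 1 + d"
    using x by (auto simp: leavitt_component_def)
  have "word_degree w = d" if w_key: "w \<in> Poly_Mapping.keys (?g * p)" for w
  proof -
    obtain u v where w: "w = u + v" and u: "u \<in> Poly_Mapping.keys ?g" and v: "v \<in> Poly_Mapping.keys p"
      using keys_mult[of ?g p] w_key by blast
    from u obtain e where "u = Word [Ghost e]"
      using keys_sum[of ghost F] by (auto simp: gen_def split: if_splits)
    then show ?thesis using deg[OF v] by (simp add: w plus_word_def word_degree_def)
  qed
  then show ?thesis
    using g p by (auto simp: leavitt_component_def L_mult lookup_mult_0 intro!: imageI)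
qed

text \<open>
  Let \<open>X\<^sub>i\<close> be the sum of the arcs in \<open>F\<^sub>i\<close> and \<open>Y\<^sub>i\<close> the sum of their ghosts. In \<open>Y\<^sub>i X\<^sub>j\<close> only the
  terms \<open>e\<^sup>* e = r(e)\<close> with \<open>i = j\<close> survive, and these ranges run through all vertices once. In
  \<open>X\<^sub>i Y\<^sub>i\<close> only the terms \<open>e e\<^sup>*\<close> survive because \<open>F\<^sub>i\<close> has distinct ranges; summed over all arcs and
  grouped by source, they give the sum of all vertices. So the \<open>X\<^sub>i\<close> and \<open>Y\<^sub>i\<close> form a Leavitt
  family.
\<close>
theorem gr_IBN_permutation_decomposition:
  fixes F :: "nat \<Rightarrow> 'e set"
  assumes arcs: "arcs E = (\<Union>i<k. F i)"
    and disj: "\<And>i j. i < k \<Longrightarrow> j < k \<Longrightarrow> i \<noteq> j \<Longrightarrow> F i \<inter> F j = {}"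
    and tail: "\<And>i. i < k \<Longrightarrow> bij_betw (tail E) (F i) (verts E)"
    and head: "\<And>i. i < k \<Longrightarrow> bij_betw (head E) (F i) (verts E)"
    and k: "k > 0" and gr: "has_gr_IBN L (leavitt_component K E)"
  shows "k = 1"
proof -
  interpret R: ring L by (rule ring_L)
  define X where "X i = (\<Sum>e\<in>F i. edge e)" for i
  define Y where "Y i = (\<Sum>e\<in>F i. ghost e)" for i
  have F: "F i \<subseteq> arcs E" "finite (F i)" if "i < k" for i
    using that arcs finite_subset[OF _ finite_arcs] by (auto simp del: finite_arcs)
  have arcsI: "e \<in> arcs E" if "e \<in> F i" "i < k" for e i using that F by blast
  have X: "X i \<in> carrier P" "Poly_Mapping.lookup (X i) 0 = 0" if "i < k" for i
    using that by (auto simp: X_def lookup_sum arcsI)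
  have Y: "Y i \<in> carrier P" "Poly_Mapping.lookup (Y i) 0 = 0" if "i < k" for i
    using that by (auto simp: Y_def lookup_sum arcsI)
  have YX: "cls (Y i) \<otimes>\<^bsub>L\<^esub> cls (X j) = (if i = j then \<one>\<^bsub>L\<^esub> else \<zero>\<^bsub>L\<^esub>)"
    if ij: "i < k" "j < k" for i j
  proof -
    have "cls (Y i * X j) = cls (\<Sum>e\<in>F i. \<Sum>f\<in>F j. if e = f then vertex (head E e) else 0)"
      unfolding X_def Y_def sum_product
      using ij by (intro cls_sum_cong) (auto simp: lpa_relations arcsI)
    also have "(\<Sum>e\<in>F i. \<Sum>f\<in>F j. if e = f then vertex (head E e) else 0)
        = (if i = j then unit_poly else 0)"
    proof (cases "i = j")
      case True
      then show ?thesis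
        using sum.reindex_bij_betw[OF head[OF ij(1)], of vertex] F(2)[OF ij(2)]
        by (simp add: unit_poly_def)
    next
      case False
      with disj[OF ij] show ?thesis by (auto intro!: sum.neutral)
    qed
    finally show ?thesis using ij by (simp add: L_mult X Y L_one L_zero)
  qed
  have "(\<Oplus>\<^bsub>L\<^esub>i\<in>{..<k}. cls (X i) \<otimes>\<^bsub>L\<^esub> cls (Y i)) = (\<Oplus>\<^bsub>L\<^esub>i\<in>{..<k}. cls (X i * Y i))"
    by (rule R.finsum_cong') (auto simp: L_mult X Y cls_in_L lookup_mult_0)
  also have "\<dots> = cls (\<Sum>i<k. X i * Y i)"
    by (rule cls_finsum) (auto simp: X Y lookup_mult_0)
  also have "\<dots> = cls (\<Sum>i<k. \<Sum>e\<in>F i. \<Sum>f\<in>F i. if e = f then edge e * ghost e else 0)"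
    unfolding X_def Y_def sum_product
  proof (intro cls_sum_cong)
    fix i e f assume i: "i \<in> {..<k}" and ef: "e \<in> F i" "f \<in> F i"
    then show "cls (edge e * ghost f) = cls (if e = f then edge e * ghost e else 0)"
      using edge_mult_ghost_distinct_heads[of e f] head[of i]
      by (auto simp: arcsI bij_betw_def dest: inj_onD)
  qed (auto simp: arcsI)
  also have "(\<Sum>i<k. \<Sum>e\<in>F i. \<Sum>f\<in>F i. if e = f then edge e * ghost e else 0)
      = (\<Sum>i<k. \<Sum>e\<in>F i. edge e * ghost e)"
    by (intro sum.cong) (auto simp: F)
  also have "\<dots> = (\<Sum>e\<in>arcs E. edge e * ghost e)"
    unfolding arcs by (rule sum.UNION_disjoint[symmetric]) (use F disj in auto)
  also have "\<dots> = (\<Sum>v\<in>verts E. \<Sum>e\<in>out_arcs E v. edge e * ghost e)"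
    unfolding out_arcs_def
    by (rule sum.group[symmetric]) auto
  also have "cls \<dots> = cls (\<Sum>v\<in>verts E. vertex v)"
  proof (rule cls_sum_cong)
    fix v assume v: "v \<in> verts E"
    then obtain e where "e \<in> F 0" "v = tail E e"
      using tail[OF k] by (auto simp: bij_betw_def)
    then have "regular_vertex E v"
      using v arcsI[OF _ k] by (auto simp: regular_vertex_def out_arcs_def)
    then show "cls (\<Sum>e\<in>out_arcs E v. edge e * ghost e) = cls (vertex v)"
      by (simp add: lpa_relations)
  qed (auto simp: out_arcs_def intro!: sum_in_free_algebra)
  finally have XY: "(\<Oplus>\<^bsub>L\<^esub>i\<in>{..<k}. cls (X i) \<otimes>\<^bsub>L\<^esub> cls (Y i)) = \<one>\<^bsub>L\<^esub>"
    by (simp add: L_one unit_poly_def)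
  have deg: "cls (Y i) \<otimes>\<^bsub>L\<^esub> x \<in> leavitt_component K E d"
    if "i < k" "x \<in> leavitt_component K E (1 + d)" for i x d
    unfolding Y_def by (rule ghost_sum_mult_component) (use that F in auto)
  show ?thesis
    by (rule R.gr_IBN_leavitt_family[of k "\<lambda>i. cls (X i)" "\<lambda>i. cls (Y i)"
          "leavitt_component K E" 1, OF _ _ YX XY deg k gr]) (simp_all add: X Y cls_in_L)
qed

end


section \<open>Cayley graphs\<close>

lemma leavitt_fin_digraph_cayley:
  assumes "group G" "finite (carrier G)" "S \<subseteq> carrier G"
  shows "leavitt_fin_digraph (cayley_graph G S)"
proof -
  interpret group G by fact
  show ?thesis
    using assms finite_subset[OF assms(3,2)]
    by unfold_locales (auto simp: cayley_graph_def subset_iff)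
qed

lemma has_IBN_cayley_if_card_1:
  fixes K :: "'k::field itself"
  assumes "group G" "finite (carrier G)" "S \<subseteq> carrier G" "card S = 1"
  shows "has_IBN (leavitt K (cayley_graph G S))"
proof -
  interpret group G by fact
  interpret leavitt_fin_digraph "cayley_graph G S" K
    by (rule leavitt_fin_digraph_cayley) fact+
  obtain s where "S = {s}" using \<open>card S = 1\<close> by (auto simp: card_1_singleton_iff)
  then show ?thesis
    by (intro has_IBN_no_branching) (auto simp: cayley_graph_def inj_on_def)
qed

text \<open>
  For a fixed generator \<open>s\<close>, the arcs labelled \<open>s\<close> start once at every vertex, and end once at
  every vertex because right translation by \<open>s\<close> is a permutation of \<open>G\<close>.
\<close>
lemma card_1_if_gr_IBN_cayley:
  fixes K :: "'k::field itself"
  assumes "group G" "finite (carrier G)" "S \<subseteq> carrier G" "S \<noteq> {}"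
    and gr: "has_gr_IBN (leavitt K (cayley_graph G S)) (leavitt_component K (cayley_graph G S))"
  shows "card S = 1"
proof -
  interpret group G by fact
  interpret leavitt_fin_digraph "cayley_graph G S" K
    by (rule leavitt_fin_digraph_cayley) fact+
  have fin: "finite S" using assms finite_subset by blast
  obtain h where h: "bij_betw h {..<card S} S"
    using ex_bij_betw_nat_finite[OF fin] by (auto simp: atLeast0LessThan)
  have hS: "h i \<in> carrier G" if "i < card S" for i
    using h that assms(3) by (auto simp: bij_betw_def)
  show ?thesis
  proof (rule gr_IBN_permutation_decomposition[where k = "card S" and F = "\<lambda>i. carrier G \<times> {h i}"])
    show "arcs (cayley_graph G S) = (\<Union>i<card S. carrier G \<times> {h i})"
      using h by (auto simp: cayley_graph_def bij_betw_def)
    fix i assume i: "i < card S"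
    show "bij_betw (tail (cayley_graph G S)) (carrier G \<times> {h i}) (verts (cayley_graph G S))"
      by (auto simp: cayley_graph_def bij_betw_def inj_on_def)
    show "bij_betw (head (cayley_graph G S)) (carrier G \<times> {h i}) (verts (cayley_graph G S))"
      by (rule bij_betw_byWitness[where f' = "\<lambda>g. (g \<otimes>\<^bsub>G\<^esub> inv\<^bsub>G\<^esub> h i, h i)"])
        (use hS[OF i] in \<open>auto simp: cayley_graph_def m_assoc\<close>)
    fix j assume "j < card S" "i \<noteq> j"
    then show "(carrier G \<times> {h i}) \<inter> (carrier G \<times> {h j}) = {}"
      using h i by (auto simp: bij_betw_def inj_on_def)
  qed (use gr fin \<open>S \<noteq> {}\<close> in \<open>auto simp: card_gt_0_iff\<close>)
qed

lemma single_cycle_cayley_if_generator: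
  assumes "group G" "finite (carrier G)" "s \<in> carrier G" "generate G {s} = carrier G"
  shows "is_single_cycle (cayley_graph G {s}) (card (carrier G))"
proof -
  interpret group G by fact
  let ?n = "card (carrier G)" and ?u = "\<lambda>i::nat. s [^]\<^bsub>G\<^esub> i"
  have n: "?n > 0" using assms one_closed by (auto simp: card_gt_0_iff)
  have ord: "ord s = ?n" using generate_pow_card[OF assms(3)] assms(4) by simp
  have sn: "s [^]\<^bsub>G\<^esub> ?n = \<one>\<^bsub>G\<^esub>" using pow_ord_eq_1[OF assms(3)] ord by simp
  have "{0..ord s - 1} = {..<?n}" using n ord by auto
  then have inj: "inj_on ?u {..<?n}" using ord_inj[OF assms(3)] by simp
  have img: "?u ` {..<?n} = carrier G"
    by (rule card_subset_eq[OF assms(2)]) (use assms in \<open>auto simp: card_image[OF inj]\<close>)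
  have head: "?u i \<otimes>\<^bsub>G\<^esub> s = ?u (Suc i mod ?n)" if "i < ?n" for i
  proof (cases "Suc i = ?n")
    case True
    then show ?thesis using sn nat_pow_Suc[of s i] by simp
  next
    case False
    with that have "Suc i mod ?n = Suc i" by simp
    then show ?thesis by simp
  qed
  show ?thesis
    unfolding is_single_cycle_def
    by (intro conjI n exI[of _ ?u] exI[of _ "\<lambda>i. (?u i, s)"])
      (use inj img head in \<open>auto simp: cayley_graph_def bij_betw_def inj_on_def\<close>)
qed

lemma card_1_if_single_cycle_cayley:
  assumes "is_single_cycle (cayley_graph G S) (card (carrier G))"
  shows "card S = 1"
proof -
  have "card (arcs (cayley_graph G S)) = card (carrier G)" and "card (carrier G) > 0"
    using assms by (auto simp: is_single_cycle_def dest!: bij_betw_same_card)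
  then show ?thesis by (simp add: cayley_graph_def card_cartesian_product)
qed


theorem proposition4p1:
  fixes K :: "'k::field itself"
    and G :: "('g, 'b) monoid_scheme"
    and S :: "'g set"
  assumes "group G"
    and "finite (carrier G)"
    and "S \<subseteq> carrier G"
    and "S \<noteq> {}"
    and "generate G S = carrier G"
  shows "(has_IBN (leavitt K (cayley_graph G S)) \<longleftrightarrow>
            has_gr_IBN (leavitt K (cayley_graph G S)) (leavitt_component K (cayley_graph G S)))
       \<and> (has_gr_IBN (leavitt K (cayley_graph G S)) (leavitt_component K (cayley_graph G S)) \<longleftrightarrow>
            card S = 1)
       \<and> (card S = 1 \<longleftrightarrow> is_single_cycle (cayley_graph G S) (card (carrier G)))"
proof -
  let ?L = "leavitt K (cayley_graph G S)" and ?A = "leavitt_component K (cayley_graph G S)"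
  have "has_IBN ?L \<Longrightarrow> has_gr_IBN ?L ?A"
    unfolding has_IBN_def has_gr_IBN_def by blast
  moreover have "has_gr_IBN ?L ?A \<Longrightarrow> card S = 1"
    using card_1_if_gr_IBN_cayley[OF assms(1-4)] .
  moreover have "card S = 1 \<Longrightarrow> has_IBN ?L"
    using has_IBN_cayley_if_card_1[OF assms(1-3)] .
  moreover have "card S = 1 \<Longrightarrow> is_single_cycle (cayley_graph G S) (card (carrier G))"
    using single_cycle_cayley_if_generator[OF assms(1,2)] assms(3,5)
    by (auto simp: card_1_singleton_iff)
  moreover have "is_single_cycle (cayley_graph G S) (card (carrier G)) \<Longrightarrow> card S = 1"
    by (rule card_1_if_single_cycle_cayley)
  ultimately show ?thesis by blast
qed

end
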